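(* A poset has the relational fixed point property (RFPP) if and only if it has the convex fixed point property (CFPP) and contains no chain of the same order type as the integers $\mathbb{Z}$. In particular RFPP and CFPP coincide for finite posets.
   Context: For a poset $P$, let $\mathfrak{P}(P)$ be the set of nonempty subsets of $P$ with the bi-dominating preorder: $X\le Y$ iff every element of $X$ is below some element of $Y$ and every element of $Y$ is above some element of $X$. A map $f:P\to\mathfrak{P}(P)$ is order preserving if $x\le y$ implies $f(x)\le f(y)$; a fixed point is $x\in P$ with $x\in f(x)$. $P$ has RFPP if every order preserving $f:P\to\mathfrak{P}(P)$ has a fixed point. $\mathcal{C}(P)$ is the set of nonempty convex subsets of $P$ with the bi-dominating order; $P$ has CFPP if every order preserving $f:P\to\mathcal{C}(P)$ has a fixed point. *)

theory Defs
  imports Main "HOL-Library.FuncSet"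
begin

definition nonempty_subsets :: "'a set \<Rightarrow> 'a set set" where
  "nonempty_subsets P = {X. X \<subseteq> P \<and> X \<noteq> {}}"

definition bidominated :: "'a rel \<Rightarrow> 'a set \<Rightarrow> 'a set \<Rightarrow> bool" where
  "bidominated r X Y \<longleftrightarrow>
     (\<forall>x\<in>X. \<exists>y\<in>Y. (x, y) \<in> r) \<and> (\<forall>y\<in>Y. \<exists>x\<in>X. (x, y) \<in> r)"

definition order_convex :: "'a set \<Rightarrow> 'a rel \<Rightarrow> 'a set \<Rightarrow> bool" where
  "order_convex P r X \<longleftrightarrow>
     (\<forall>x\<in>X. \<forall>z\<in>X. \<forall>y\<in>P. (x, y) \<in> r \<longrightarrow> (y, z) \<in> r \<longrightarrow> y \<in> X)"

definition convex_subsets :: "'a set \<Rightarrow> 'a rel \<Rightarrow> 'a set set" where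
  "convex_subsets P r = {X \<in> nonempty_subsets P. order_convex P r X}"

definition RFPP :: "'a set \<Rightarrow> 'a rel \<Rightarrow> bool" where
  "RFPP P r \<longleftrightarrow>
     (\<forall>f \<in> P \<rightarrow> nonempty_subsets P.
        monotone_on P (\<lambda>x y. (x, y) \<in> r) (bidominated r) f \<longrightarrow> (\<exists>x\<in>P. x \<in> f x))"

definition CFPP :: "'a set \<Rightarrow> 'a rel \<Rightarrow> bool" where
  "CFPP P r \<longleftrightarrow>
     (\<forall>f \<in> P \<rightarrow> convex_subsets P r.
        monotone_on P (\<lambda>x y. (x, y) \<in> r) (bidominated r) f \<longrightarrow> (\<exists>x\<in>P. x \<in> f x))"

definition has_order_type_int :: "'a rel \<Rightarrow> 'a set \<Rightarrow> bool" where
  "has_order_type_int r C \<longleftrightarrow>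
     (\<exists>g :: int \<Rightarrow> 'a. bij_betw g UNIV C \<and> (\<forall>i j. i \<le> j \<longleftrightarrow> (g i, g j) \<in> r))"

end

(*
If some chain C has the order type of the integers, then all subsets of C that are unbounded in
both directions are equivalent for the bi-dominating preorder, so x \<mapsto> C - {x} is order
preserving, and it has no fixed point. Conversely, a set is equivalent to its convex hull, so CFPP
yields x with a \<le> x \<le> b and a, b \<in> f x. Monotonicity propagates x \<le> b \<in> f x to
some c \<in> f b with b \<le> c, and so on upwards, and dually downwards from a; unless f has a
fixed point, all these inequalities are strict and the elements form a chain of type Z.
*)
theory Submission
  imports Defs
begin

lemma partial_order_onD:
  assumes "partial_order_on P r"
  shows "x \<in> P \<Longrightarrow> (x, x) \<in> r" "trans r" "antisym r"
  using assms unfolding partial_order_on_def preorder_on_def refl_on_def by blast+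

text \<open>Allows the descending half of the integer chain to be built by the same construction as
  the ascending half.\<close>

lemma bidominated_converse: "bidominated (r\<inverse>) X Y \<longleftrightarrow> bidominated r Y X"
  unfolding bidominated_def by auto

lemma bidominated_trans:
  assumes "trans r" "bidominated r X Y" "bidominated r Y Z"
  shows "bidominated r X Z"
  using assms unfolding bidominated_def trans_def by meson

definition convex_hull_in :: "'a set \<Rightarrow> 'a rel \<Rightarrow> 'a set \<Rightarrow> 'a set" where
  "convex_hull_in P r X = {y \<in> P. \<exists>a\<in>X. \<exists>b\<in>X. (a, y) \<in> r \<and> (y, b) \<in> r}"

lemma subset_convex_hull_in:
  assumes "partial_order_on P r" "X \<subseteq> P"
  shows "X \<subseteq> convex_hull_in P r X"
  using assms(2) partial_order_onD(1)[OF assms(1)] by (auto simp: convex_hull_in_def)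

lemma convex_hull_in_convex_subsets:
  assumes "partial_order_on P r" "X \<in> nonempty_subsets P"
  shows "convex_hull_in P r X \<in> convex_subsets P r"
proof -
  have "X \<subseteq> P" "X \<noteq> {}"
    using assms(2) by (auto simp: nonempty_subsets_def)
  then have "convex_hull_in P r X \<in> nonempty_subsets P"
    using subset_convex_hull_in[OF assms(1), of X]
    unfolding nonempty_subsets_def convex_hull_in_def by blast
  moreover have "trans r"
    using assms(1) by (rule partial_order_onD)
  \<comment> \<open>For \<open>y\<close> between two hull elements, the lower bound in
    \<open>X\<close> of the first and the upper bound in \<open>X\<close> of the second also enclose
    \<open>y\<close>.\<close>
  then have "order_convex P r (convex_hull_in P r X)"
    unfolding order_convex_def convex_hull_in_def by (blast dest: transD)
  ultimately show ?thesis
    by (simp add: convex_subsets_def)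
qed

lemma bidominated_convex_hull_in:
  assumes "partial_order_on P r" "X \<subseteq> P"
  shows "bidominated r X (convex_hull_in P r X)" "bidominated r (convex_hull_in P r X) X"
proof -
  have refl: "(x, x) \<in> r" if "x \<in> X" for x
    using assms that by (blast intro: partial_order_onD)
  show "bidominated r X (convex_hull_in P r X)" "bidominated r (convex_hull_in P r X) X"
    using subset_convex_hull_in[OF assms] refl
    unfolding bidominated_def by (auto simp: convex_hull_in_def)
qed

text \<open>The relation \<open>s\<close> is left arbitrary so that it can be \<open>r\<close> for
  the upward sequence and \<open>r\<inverse>\<close> for the downward one.\<close>

lemma iterate_related_choice:
  assumes "x \<in> P" "y \<in> f x" "(x, y) \<in> s" "f \<in> P \<rightarrow> nonempty_subsets P"
    and mono: "\<And>x y. x \<in> P \<Longrightarrow> y \<in> P \<Longrightarrow> (x, y) \<in> s \<Longrightarrow> bidominated s (f x) (f y)"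
  obtains u :: "nat \<Rightarrow> 'a" where "u 0 = x" "\<And>n. u n \<in> P"
    "\<And>n. u (Suc n) \<in> f (u n)" "\<And>n. (u n, u (Suc n)) \<in> s"
proof -
  \<comment> \<open>The invariant promises a successor in \<open>f p\<close>; monotonicity renews
    this promise at the chosen successor. The last conjunct pins the starting point.\<close>
  let ?A = "\<lambda>n p. p \<in> P \<and> (\<exists>q\<in>f p. (p, q) \<in> s) \<and> (n = 0 \<longrightarrow> p = x)"
  have "\<exists>u. \<forall>n. ?A n (u n) \<and> u (Suc n) \<in> f (u n) \<and> (u n, u (Suc n)) \<in> s"
  proof (rule dependent_nat_choice)
    show "\<exists>p. ?A 0 p"
      using assms(1-3) by blast
  next
    fix p and n :: nat
    assume "?A n p"
    then obtain q where q: "p \<in> P" "q \<in> f p" "(p, q) \<in> s"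
      by blast
    then have "q \<in> P"
      using assms(4) by (auto simp: nonempty_subsets_def)
    moreover from this have "\<exists>q'\<in>f q. (q, q') \<in> s"
      using mono[of p q] q by (auto simp: bidominated_def)
    ultimately show "\<exists>q. ?A (Suc n) q \<and> q \<in> f p \<and> (p, q) \<in> s"
      using q by blast
  qed
  then show thesis
    using that by blast
qed

lemma int_chainI:
  fixes g :: "int \<Rightarrow> 'a"
  assumes "partial_order_on P r" "range g \<subseteq> P"
    and step: "\<And>i. (g i, g (i + 1)) \<in> r" "\<And>i. g i \<noteq> g (i + 1)"
  shows "range g \<in> Chains r" "has_order_type_int r (range g)"
proof -
  have r: "trans r" "antisym r" "\<And>i. (g i, g i) \<in> r"
    using partial_order_onD[OF assms(1)] assms(2) by blast+
  have less: "(g i, g j) \<in> r \<and> g i \<noteq> g j" if "i < j" for i j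
    using that
  proof (induction j rule: int_gr_induct)
    case base
    then show ?case using step by blast
  next
    case (step j)
    \<comment> \<open>If \<open>g i = g (j + 1)\<close>, then \<open>g j\<close> lies both above and
      below \<open>g i\<close>, so antisymmetry contradicts the induction hypothesis.\<close>
    then show ?case
      using r assms(3,4) by (metis antisymD transD)
  qed
  have le: "(g i, g j) \<in> r" if "i \<le> j" for i j
    using that less r(3) by (cases "i = j") auto
  have "i \<le> j \<longleftrightarrow> (g i, g j) \<in> r" for i j
    using le less r(2) by (metis antisymD linorder_not_le order_less_imp_le)
  moreover have "inj g"
    using less by (metis injI linorder_neqE)
  ultimately show "has_order_type_int r (range g)"
    unfolding has_order_type_int_def by (intro exI[of _ g]) (simp add: inj_on_imp_bij_betw)
  show "range g \<in> Chains r"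
    unfolding Chains_def by (auto, meson le linear)
qed

lemma int_order_type_infinite: "has_order_type_int r C \<Longrightarrow> infinite C"
  unfolding has_order_type_int_def using bij_betw_finite infinite_UNIV_int by blast

lemma RFPP_imp_CFPP: "RFPP P r \<Longrightarrow> CFPP P r"
  unfolding RFPP_def CFPP_def convex_subsets_def by (auto simp: Pi_iff)

lemma RFPP_imp_no_int_chain:
  assumes "RFPP P r" "C \<subseteq> P" "has_order_type_int r C"
  shows False
proof -
  from assms(3) obtain g :: "int \<Rightarrow> 'a" where g: "bij_betw g UNIV C"
    and le: "\<And>i j. i \<le> j \<longleftrightarrow> (g i, g j) \<in> r"
    unfolding has_order_type_int_def by blast
  from g have C: "C = range g" and inj: "inj g"
    by (auto simp: bij_betw_def)
  \<comment> \<open>By injectivity \<open>x\<close> equals at most one of \<open>g i\<close> and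
    \<open>g (i + 1)\<close>, so deleting it leaves \<open>C\<close> unbounded above.\<close>
  have above: "\<exists>j. g j \<noteq> x \<and> i \<le> j" for i x
  proof (cases "g i = x")
    case True
    then have "g (i + 1) \<noteq> x"
      using inj by (auto simp: inj_eq)
    then show ?thesis
      by (intro exI[of _ "i + 1"]) simp
  qed blast
  have below: "\<exists>j. g j \<noteq> x \<and> j \<le> i" for i x
  proof (cases "g i = x")
    case True
    then have "g (i - 1) \<noteq> x"
      using inj by (auto simp: inj_eq)
    then show ?thesis
      by (intro exI[of _ "i - 1"]) simp
  qed blast
  have "bidominated r (C - {x}) (C - {y})" for x y
    unfolding bidominated_def C using above below le by blast
  then have "monotone_on P (\<lambda>x y. (x, y) \<in> r) (bidominated r) (\<lambda>x. C - {x})"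
    by (simp add: monotone_on_def)
  moreover have "C - {x} \<noteq> {}" for x
    using above C by blast
  then have "(\<lambda>x. C - {x}) \<in> P \<rightarrow> nonempty_subsets P"
    using assms(2) by (auto simp: nonempty_subsets_def)
  ultimately have "\<exists>x\<in>P. x \<in> C - {x}"
    using assms(1) unfolding RFPP_def by blast
  then show False
    by blast
qed

lemma CFPP_imp_RFPP:
  assumes po: "partial_order_on P r" and "CFPP P r"
    and no_chain: "\<not> (\<exists>C. C \<subseteq> P \<and> C \<in> Chains r \<and> has_order_type_int r C)"
  shows "RFPP P r"
  unfolding RFPP_def
proof (intro ballI impI, rule ccontr)
  fix f
  assume f: "f \<in> P \<rightarrow> nonempty_subsets P"
    and mono: "monotone_on P (\<lambda>x y. (x, y) \<in> r) (bidominated r) f"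
    and no_fix: "\<not> (\<exists>x\<in>P. x \<in> f x)"
  have "trans r"
    using po by (rule partial_order_onD)
  have sub: "f x \<subseteq> P" if "x \<in> P" for x
    using f that by (auto simp: nonempty_subsets_def)
  have dom: "bidominated r (f x) (f y)" if "x \<in> P" "y \<in> P" "(x, y) \<in> r" for x y
    using mono that by (simp add: monotone_on_def)
  let ?h = "\<lambda>x. convex_hull_in P r (f x)"
  \<comment> \<open>Composes \<open>?h x\<close> \<le> \<open>f x\<close> \<le> \<open>f y\<close>
    \<le> \<open>?h y\<close>, the outer two because a set and its hull are equivalent.\<close>
  have "bidominated r (?h x) (?h y)" if "x \<in> P" "y \<in> P" "(x, y) \<in> r" for x y
    using bidominated_convex_hull_in[OF po sub] dom[OF that] that
    by (meson \<open>trans r\<close> bidominated_trans)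
  then have "monotone_on P (\<lambda>x y. (x, y) \<in> r) (bidominated r) ?h"
    by (simp add: monotone_on_def)
  moreover have "?h \<in> P \<rightarrow> convex_subsets P r"
    using f convex_hull_in_convex_subsets[OF po] by blast
  ultimately obtain x where "x \<in> P" "x \<in> ?h x"
    using \<open>CFPP P r\<close> unfolding CFPP_def by blast
  then obtain a b where ab: "a \<in> f x" "b \<in> f x" "(a, x) \<in> r" "(x, b) \<in> r"
    by (auto simp: convex_hull_in_def)
  obtain u where u: "u 0 = x" "\<And>n. u n \<in> P" "\<And>n. u (Suc n) \<in> f (u n)"
      "\<And>n. (u n, u (Suc n)) \<in> r"
    using iterate_related_choice[OF \<open>x \<in> P\<close> ab(2,4) f dom] by blast
  have xa: "(x, a) \<in> r\<inverse>"
    using ab(3) by simp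
  have dom': "bidominated (r\<inverse>) (f y) (f z)" if "y \<in> P" "z \<in> P" "(y, z) \<in> r\<inverse>" for y z
    using dom[of z y] that by (simp add: bidominated_converse)
  obtain d where d: "d 0 = x" "\<And>n. d n \<in> P" "\<And>n. d (Suc n) \<in> f (d n)"
      "\<And>n. (d n, d (Suc n)) \<in> r\<inverse>"
    using iterate_related_choice[OF \<open>x \<in> P\<close> ab(1) xa f dom'] by blast
  \<comment> \<open>The two sequences are glued at index 0, where both equal \<open>x\<close>; the
    downward one is traversed backwards.\<close>
  define g where "g i = (if i \<ge> 0 then u (nat i) else d (nat (- i)))" for i :: int
  have step: "(g i, g (i + 1)) \<in> r \<and> g i \<noteq> g (i + 1)" for i
  proof (cases "i \<ge> 0")
    case True
    then have "g i = u (nat i)" "g (i + 1) = u (Suc (nat i))"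
      by (auto simp: g_def nat_add_distrib)
    \<comment> \<open>Equality of neighbours would put \<open>u (nat i)\<close> into its own image
      under \<open>f\<close>.\<close>
    then show ?thesis
      using u no_fix by metis
  next
    case False
    \<comment> \<open>For \<open>i = -1\<close> this gives \<open>n = 0\<close>, and
      \<open>g 0\<close> is computed from \<open>u\<close>; there \<open>u 0 = d 0\<close> is what
      makes \<open>g (i + 1) = d n\<close> true.\<close>
    define n where "n = nat (- i - 1)"
    have "g i = d (Suc n)" "g (i + 1) = d n"
      using False u(1) d(1) by (auto simp: g_def n_def Suc_nat_eq_nat_zadd1)
    then show ?thesis
      using d no_fix by (metis converse_iff)
  qed
  have "range g \<subseteq> P"
    using u(2) d(2) by (auto simp: g_def)
  with step no_chain show False
    using int_chainI[OF po, of g] by blast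
qed

theorem theorem3:
  fixes P :: "'a set" and r :: "'a rel"
  assumes "partial_order_on P r"
  shows "(RFPP P r \<longleftrightarrow>
            CFPP P r \<and> \<not> (\<exists>C. C \<subseteq> P \<and> C \<in> Chains r \<and> has_order_type_int r C))
         \<and> (finite P \<longrightarrow> (RFPP P r \<longleftrightarrow> CFPP P r))"
proof -
  let ?Z = "\<exists>C. C \<subseteq> P \<and> C \<in> Chains r \<and> has_order_type_int r C"
  have iff: "RFPP P r \<longleftrightarrow> CFPP P r \<and> \<not> ?Z"
    using RFPP_imp_CFPP RFPP_imp_no_int_chain CFPP_imp_RFPP[OF assms] by blast
  have "\<not> ?Z" if "finite P"
    using that int_order_type_infinite finite_subset by blast
  with iff show ?thesis
    by blast
qed

end
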